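(* For each $n$ let $\bm\mu=\bm\mu^{(n)}=(\mu_1,\dots,\mu_n)$ be a vector of positive reals (the entries may depend on $n$), and let $T_n$ be the number of triangles in the $\beta$-model on $n$ vertices with parameter vector $\bm\mu$, i.e. with independent edges of probabilities $p_{ij}=\mu_i\mu_j/(1+\mu_i\mu_j)$. Suppose that, as $n\to\infty$, $\mu_{\max}\to 0$ and $\|\bm\mu\|_2\to\infty$. Then, as $n\to\infty$, $$\mathbb{E}[T_n]=\tfrac16\|\bm\mu\|_2^6\,(1+o(1)),$$ $$\mathrm{Var}[T_n]=\tfrac16\|\bm\mu\|_2^4\big(3\|\bm\mu\|_3^6+\|\bm\mu\|_2^2\big)(1+o(1)).$$
   Context: The $\beta$-model on vertex set $[n]=\{1,\dots,n\}$ with parameters $\beta_1,\dots,\beta_n\in\mathbb{R}$ (possibly depending on $n$) is the random simple undirected graph in which, for each pair $i\ne j$, the edge $\{i,j\}$ is present with probability $p_{ij}=e^{\beta_i+\beta_j}/(1+e^{\beta_i+\beta_j})$, independently over unordered pairs. Writing $\mu_i=e^{\beta_i}>0$, we have $p_{ij}=\mu_i\mu_j/(1+\mu_i\mu_j)$. Let $I_{ij}=I_{ji}$ be the indicator that the edge $\{i,j\}$ is present. The number of triangles is $T_n=\sum_{1\le i<j<k\le n}I_{ij}I_{jk}I_{ki}$. For a vector $\bm x\in\mathbb{R}^n$ and $s>0$, $\|\bm x\|_s=(\sum_{i=1}^n|x_i|^s)^{1/s}$, and $x_{\max}$ is the maximal entry of $\bm x$. *)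

theory Defs
  imports "HOL-Probability.Probability" "HOL-Library.Landau_Symbols"
begin

text \<open>
  A simple undirected graph on the vertex set \<open>{1..n}\<close> is represented by its edge set, a set of
  two-element subsets of \<open>{1..n}\<close>. The parameters are \<open>\<mu> i = exp (\<beta> i)\<close>, and only
  \<open>\<mu> 1, \<dots>, \<mu> n\<close> matter.
\<close>

definition vertex_pairs :: "nat \<Rightarrow> nat set set" where
  "vertex_pairs n = {{i, j} | i j. 1 \<le> i \<and> i < j \<and> j \<le> n}"

definition edge_prob :: "(nat \<Rightarrow> real) \<Rightarrow> nat \<Rightarrow> nat \<Rightarrow> real" where
  "edge_prob \<mu> i j = \<mu> i * \<mu> j / (1 + \<mu> i * \<mu> j)"

text \<open>
  The endpoints of a pair \<open>e\<close> are recovered as \<open>Min e\<close> and \<open>Max e\<close>; \<open>edge_prob\<close> is symmetric, so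
  their order is immaterial. For positive parameters the edge probabilities lie in \<open>[0, 1]\<close>, so
  the truncation built into \<open>bernoulli_pmf\<close> has no effect. \<open>Pi_pmf\<close> is the product distribution,
  so distinct pairs are independent.
\<close>

definition beta_model :: "nat \<Rightarrow> (nat \<Rightarrow> real) \<Rightarrow> nat set set pmf" where
  "beta_model n \<mu> =
     map_pmf (\<lambda>present. {e \<in> vertex_pairs n. present e})
       (Pi_pmf (vertex_pairs n) False (\<lambda>e. bernoulli_pmf (edge_prob \<mu> (Min e) (Max e))))"

definition edge_ind :: "nat set set \<Rightarrow> nat \<Rightarrow> nat \<Rightarrow> real" where
  "edge_ind G i j = (if {i, j} \<in> G then 1 else 0)"

definition triangle_count :: "nat \<Rightarrow> nat set set \<Rightarrow> real" where
  "triangle_count n G =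
     (\<Sum>(i, j, k) \<in> {(i, j, k). 1 \<le> i \<and> i < j \<and> j < k \<and> k \<le> n}.
        edge_ind G i j * edge_ind G j k * edge_ind G k i)"

definition vec_norm :: "real \<Rightarrow> nat \<Rightarrow> (nat \<Rightarrow> real) \<Rightarrow> real" where
  "vec_norm s n x = (\<Sum>i = 1..n. \<bar>x i\<bar> powr s) powr (1 / s)"

text \<open>Meaningful for \<open>n \<ge> 1\<close> only.\<close>

definition vec_max :: "nat \<Rightarrow> (nat \<Rightarrow> real) \<Rightarrow> real" where
  "vec_max n x = Max (x ` {1..n})"

end

theory Submission
  imports Defs "HOL-Library.Ramsey"
begin

text \<open>
  Write the triangle count as a sum, over the three-element vertex sets \<open>A\<close>, of the indicator that
  all pairs in \<open>A\<close> are edges. Two such indicators are independent unless their vertex sets share at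
  least two points, so the variance is the sum over \<open>A\<close> of the variances plus the sum of the
  covariances over ordered pairs \<open>{i, j, k}\<close>, \<open>{i, j, l}\<close>. Let \<open>S2\<close>, \<open>S3\<close> be the second and third power
  sums of the parameters and \<open>d\<close> the square of their maximum. As
  \<open>(1 - d) \<mu> i \<mu> j \<le> p i j \<le> \<mu> i \<mu> j \<le> d\<close>, every term equals its product of powers of the parameters up
  to a factor between \<open>(1 - d) ^ 6\<close> and \<open>1\<close>. Replacing sums over distinct indices by sums over all
  indices costs at most \<open>3 d S2 ^ 2\<close> in the sum over triples, against \<open>S2 ^ 3\<close>, and at most
  \<open>d ^ 2 S2 ^ 3 + 5 d S3 ^ 2 S2\<close> in the sum over quadruples, against \<open>S2 ^ 3 + S3 ^ 2 S2 ^ 2\<close>.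
\<close>

section \<open>Sums over three-element sets as sums over ordered tuples\<close>

definition triples :: "'a set \<Rightarrow> ('a \<times> 'a \<times> 'a) set" where
  "triples V = {(i, j, k). i \<in> V \<and> j \<in> V \<and> k \<in> V \<and> distinct [i, j, k]}"

text \<open>A tuple \<open>(i, j, k, l)\<close> encodes two triangles on the common edge
  \<open>{i, j}\<close>, with third vertices \<open>k\<close> and \<open>l\<close>.\<close>

definition quadruples :: "'a set \<Rightarrow> ('a \<times> 'a \<times> 'a \<times> 'a) set" where
  "quadruples V =
     {(i, j, k, l). i \<in> V \<and> j \<in> V \<and> k \<in> V \<and> l \<in> V \<and> distinct [i, j, k, l]}"

definition pair_prob :: "(nat \<Rightarrow> real) \<Rightarrow> nat set \<Rightarrow> real" where
  "pair_prob \<mu> e = edge_prob \<mu> (Min e) (Max e)"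

lemma finite_triples: "finite V \<Longrightarrow> finite (triples V)"
  by (rule finite_subset[of _ "V \<times> V \<times> V"]) (auto simp: triples_def)

lemma finite_quadruples: "finite V \<Longrightarrow> finite (quadruples V)"
  by (rule finite_subset[of _ "V \<times> V \<times> V \<times> V"]) (auto simp: quadruples_def)

text \<open>Grouping by underlying set: each three-element set has 3! orderings. Ordered tuples are
  preferred because, up to diagonal terms, their sums factor into products of power sums.\<close>

lemma sum_triples_eq:
  fixes g :: "'a set \<Rightarrow> real"
  assumes "finite V"
  shows "(\<Sum>(i, j, k) \<in> triples V. g {i, j, k}) = 6 * (\<Sum>A \<in> nsets V 3. g A)"
proof -
  let ?s = "\<lambda>(i, j, k). {i, j, k}"
  have "(\<Sum>(i, j, k) \<in> triples V. g {i, j, k}) = (\<Sum>t \<in> triples V. g (?s t))"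
    by (simp add: case_prod_unfold)
  also have "\<dots> = (\<Sum>A \<in> nsets V 3. \<Sum>t \<in> {t \<in> triples V. ?s t = A}. g (?s t))"
    using assms
    by (intro sum.group[symmetric] finite_triples finite_imp_finite_nsets)
      (auto simp: triples_def nsets_def)
  also have "\<dots> = (\<Sum>A \<in> nsets V 3. 6 * g A)"
  proof (rule sum.cong[OF refl])
    fix A assume "A \<in> nsets V 3"
    then obtain a b c where A: "A = {a, b, c}" "a \<noteq> b" "a \<noteq> c" "b \<noteq> c" "{a, b, c} \<subseteq> V"
      by (auto simp: nsets_def card_3_iff)
    have "{t \<in> triples V. ?s t = A} =
        {(a, b, c), (a, c, b), (b, a, c), (b, c, a), (c, a, b), (c, b, a)}" (is "_ = ?R")
    proof (intro subset_antisym subsetI)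
      fix t assume "t \<in> {t \<in> triples V. ?s t = A}"
      then obtain i j k where t: "t = (i, j, k)" "distinct [i, j, k]" "{i, j, k} = A"
        by (auto simp: triples_def)
      then have "i \<in> {a, b, c}" "j \<in> {a, b, c}" "k \<in> {a, b, c}"
        unfolding A(1) by blast+
      with t(1,2) show "t \<in> ?R"
        by auto
    next
      fix t assume "t \<in> ?R"
      then show "t \<in> {t \<in> triples V. ?s t = A}"
        using A by (auto simp: triples_def)
    qed
    then have "card {t \<in> triples V. ?s t = A} = 6"
      using A by simp
    then show "(\<Sum>t \<in> {t \<in> triples V. ?s t = A}. g (?s t)) = 6 * g A"
      by simp
  qed
  finally show ?thesis
    by (simp add: sum_distrib_left)
qed

lemma card_3_Int_2E:
  assumes "card A = 3" "card B = 3" "card (A \<inter> B) = 2"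
  obtains a b c d where "A = {a, b, c}" "B = {a, b, d}" "distinct [a, b, c, d]"
proof -
  have fin: "finite A" "finite B"
    using assms by (auto intro: card_ge_0_finite)
  from assms(3) obtain a b where ab: "A \<inter> B = {a, b}" "a \<noteq> b"
    by (auto simp: card_2_iff)
  have "card (A - A \<inter> B) = 1" "card (B - A \<inter> B) = 1"
    using assms fin by (auto simp: card_Diff_subset)
  then obtain c d where cd: "A - A \<inter> B = {c}" "B - A \<inter> B = {d}"
    by (auto simp: card_1_singleton_iff)
  have "A = {a, b, c}" "B = {a, b, d}" "distinct [a, b, c, d]"
    using ab cd by auto
  then show ?thesis
    using that by blast
qed

text \<open>In the ordered pair \<open>(A, B)\<close> the vertices \<open>k\<close> and
  \<open>l\<close> are determined as the elements of \<open>A - B\<close> and \<open>B - A\<close>.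
  Only the two elements of \<open>A \<inter> B\<close> can be swapped, hence the factor 2.\<close>

lemma sum_quadruples_eq:
  fixes g :: "'a set \<Rightarrow> 'a set \<Rightarrow> real"
  assumes "finite V"
  shows "(\<Sum>(i, j, k, l) \<in> quadruples V. g {i, j, k} {i, j, l}) =
    2 * (\<Sum>A \<in> nsets V 3. \<Sum>B \<in> {B \<in> nsets V 3. card (A \<inter> B) = 2}. g A B)"
proof -
  let ?s = "\<lambda>(i, j, k, l). ({i, j, k}, {i, j, l})"
  let ?P = "SIGMA A : nsets V 3. {B \<in> nsets V 3. card (A \<inter> B) = 2}"
  have "(\<Sum>(i, j, k, l) \<in> quadruples V. g {i, j, k} {i, j, l}) =
      (\<Sum>t \<in> quadruples V. case_prod g (?s t))"
    by (simp add: case_prod_unfold)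
  also have "\<dots> = (\<Sum>P \<in> ?P. \<Sum>t \<in> {t \<in> quadruples V. ?s t = P}. case_prod g (?s t))"
  proof (rule sum.group[symmetric])
    show "finite (quadruples V)" "finite ?P"
      using assms by (simp_all add: finite_quadruples finite_imp_finite_nsets)
    show "?s ` quadruples V \<subseteq> ?P"
    proof (rule image_subsetI)
      fix t assume "t \<in> quadruples V"
      then obtain i j k l where t: "t = (i, j, k, l)" "distinct [i, j, k, l]" "{i, j, k, l} \<subseteq> V"
        by (auto simp: quadruples_def)
      moreover from t have "{i, j, k} \<inter> {i, j, l} = {i, j}"
        by auto
      ultimately show "?s t \<in> ?P"
        by (simp add: nsets_def)
    qed
  qed
  also have "\<dots> = (\<Sum>P \<in> ?P. 2 * case_prod g P)"
  proof (rule sum.cong[OF refl])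
    fix P assume "P \<in> ?P"
    then obtain A B where P: "P = (A, B)" "A \<in> nsets V 3" "B \<in> nsets V 3" "card (A \<inter> B) = 2"
      by auto
    then have "card A = 3" "card B = 3"
      by (simp_all add: nsets_def)
    then obtain a b c d where AB: "A = {a, b, c}" "B = {a, b, d}" "distinct [a, b, c, d]"
      using P(4) by (rule card_3_Int_2E)
    have "{t \<in> quadruples V. ?s t = P} = {(a, b, c, d), (b, a, c, d)}"
    proof (intro subset_antisym subsetI)
      fix t assume "t \<in> {t \<in> quadruples V. ?s t = P}"
      then obtain i j k l where t: "t = (i, j, k, l)" "distinct [i, j, k, l]"
          "{i, j, k} = A" "{i, j, l} = B"
        unfolding P(1) quadruples_def by auto
      have "{i, j} = A \<inter> B" "{k} = A - B" "{l} = B - A"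
        using t(2) unfolding t(3,4)[symmetric] by auto
      moreover have "A \<inter> B = {a, b}" "A - B = {c}" "B - A = {d}"
        using AB(3) unfolding AB(1,2) by auto
      ultimately show "t \<in> {(a, b, c, d), (b, a, c, d)}"
        unfolding t(1) by (simp add: doubleton_eq_iff)
    next
      fix t assume "t \<in> {(a, b, c, d), (b, a, c, d)}"
      then show "t \<in> {t \<in> quadruples V. ?s t = P}"
        using P(2,3) AB by (auto simp: P(1) quadruples_def nsets_def)
    qed
    then have "card {t \<in> quadruples V. ?s t = P} = 2"
      using AB by simp
    then show "(\<Sum>t \<in> {t \<in> quadruples V. ?s t = P}. case_prod g (?s t)) = 2 * case_prod g P"
      by simp
  qed
  also have "\<dots> = 2 * (\<Sum>A \<in> nsets V 3. \<Sum>B \<in> {B \<in> nsets V 3. card (A \<inter> B) = 2}. g A B)"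
    by (simp add: sum_distrib_left[symmetric] sum.Sigma[symmetric] assms finite_imp_finite_nsets)
  finally show ?thesis .
qed

section \<open>The triangle count as a sum of subset indicators\<close>

lemma nsets_2_triple:
  assumes "distinct [a, b, c]"
  shows "nsets {a, b, c} 2 = {{a, b}, {b, c}, {c, a}}"
  using assms by (auto simp: nsets_2_eq)

lemma nsets_Int: "nsets A k \<inter> nsets B k = nsets (A \<inter> B) k"
  by (auto simp: nsets_def)

lemma vertex_pairs_eq: "vertex_pairs n = nsets {1..n} 2"
  unfolding vertex_pairs_def ordered_nsets_2_eq by fastforce

text \<open>Each three-element set has exactly one increasing enumeration. With indicators of the
  form \<open>nsets A 2 \<subseteq> G\<close>, a product of two of them is the indicator for a union
  of edge sets, which suits second moments.\<close>

lemma triangle_count_eq: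
  "triangle_count n G = (\<Sum>A \<in> nsets {1..n} 3. of_bool (nsets A 2 \<subseteq> G))"
proof -
  let ?I = "{(i, j, k). 1 \<le> i \<and> i < j \<and> j < k \<and> k \<le> n}"
  let ?s = "\<lambda>(i, j, k). {i, j, k :: nat}"
  have "bij_betw ?s ?I (nsets {1..n} 3)"
    unfolding bij_betw_def
  proof (intro conjI subset_antisym subsetI)
    show "inj_on ?s ?I"
    proof (rule inj_onI)
      fix t t' assume "t \<in> ?I" "t' \<in> ?I" "?s t = ?s t'"
      moreover obtain i j k i' j' k' where t: "t = (i, j, k)" "t' = (i', j', k')"
        by (metis prod_cases3)
      ultimately have *: "{i, j, k} = {i', j', k'}" "i < j" "j < k" "i' < j'" "j' < k'"
        by auto
      then have "i' \<in> {i, j, k}" "j' \<in> {i, j, k}" "k' \<in> {i, j, k}"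
        by simp_all
      with *(2-5) show "t = t'"
        unfolding t by auto
    qed
  next
    fix A assume "A \<in> ?s ` ?I"
    then show "A \<in> nsets {1..n} 3"
      by (auto simp: nsets_def)
  next
    fix A assume "A \<in> nsets {1..n} 3"
    then obtain a b c where A: "A = {a, b, c}" "a \<noteq> b" "a \<noteq> c" "b \<noteq> c" "{a, b, c} \<subseteq> {1..n}"
      by (auto simp: nsets_def card_3_iff)
    have "\<exists>i j k. i < j \<and> j < k \<and> {i, j, k} = A"
      using A(2-4) unfolding A(1) by (metis insert_commute linorder_neqE_nat)
    then obtain i j k where "i < j" "j < k" "{i, j, k} = A"
      by blast
    moreover from this have "1 \<le> i" "k \<le> n"
      using A(1,5) by auto
    ultimately show "A \<in> ?s ` ?I"
      by (intro image_eqI[of _ _ "(i, j, k)"]) auto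
  qed
  then have "(\<Sum>A \<in> nsets {1..n} 3. of_bool (nsets A 2 \<subseteq> G)) =
      (\<Sum>t \<in> ?I. of_bool (nsets (?s t) 2 \<subseteq> G) :: real)"
    by (rule sum.reindex_bij_betw[symmetric])
  also have "\<dots> = triangle_count n G"
    unfolding triangle_count_def
    by (rule sum.cong) (auto simp: nsets_2_triple edge_ind_def split: if_splits)
  finally show ?thesis ..
qed

section \<open>Edge probabilities and the exact mean and variance\<close>

lemma edge_prob_bounds:
  assumes "\<mu> i > 0" "\<mu> j > 0"
  shows "0 \<le> edge_prob \<mu> i j" "edge_prob \<mu> i j \<le> 1" "edge_prob \<mu> i j \<le> \<mu> i * \<mu> j"
    "\<mu> i * \<mu> j \<le> d \<Longrightarrow> (1 - d) * (\<mu> i * \<mu> j) \<le> edge_prob \<mu> i j"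
proof -
  define x where "x = \<mu> i * \<mu> j"
  have x: "x > 0"
    using assms by (simp add: x_def)
  show "0 \<le> edge_prob \<mu> i j" "edge_prob \<mu> i j \<le> 1" "edge_prob \<mu> i j \<le> \<mu> i * \<mu> j"
    using x by (auto simp: edge_prob_def x_def[symmetric] field_simps)
  assume "\<mu> i * \<mu> j \<le> d"
  then have "(1 - d) * x \<le> (1 - x) * x"
    using x by (intro mult_right_mono) (auto simp: x_def)
  \<comment> \<open>This is \<open>(1 - x) * (1 + x) = 1 - x ^ 2 \<le> 1\<close>, divided by
    \<open>1 + x\<close> and multiplied by \<open>x\<close>.\<close>
  also have "\<dots> \<le> x / (1 + x)"
    using x by (simp add: field_simps)
  finally show "(1 - d) * (\<mu> i * \<mu> j) \<le> edge_prob \<mu> i j"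
    by (simp add: edge_prob_def x_def)
qed

lemma pair_prob_pair: "pair_prob \<mu> {i, j} = edge_prob \<mu> i j"
  by (auto simp: pair_prob_def edge_prob_def min_def max_def mult.commute)

lemma pair_prob_bounds:
  assumes "\<And>i. i \<in> {1..n} \<Longrightarrow> \<mu> i > 0" "e \<in> vertex_pairs n"
  shows "0 \<le> pair_prob \<mu> e" "pair_prob \<mu> e \<le> 1"
  using assms(2) unfolding vertex_pairs_eq
  by (auto elim!: nsets2_E simp: pair_prob_pair intro!: edge_prob_bounds assms(1))

lemma finite_vertex_pairs: "finite (vertex_pairs n)"
  by (simp add: vertex_pairs_eq finite_imp_finite_nsets)

lemma finite_set_beta_model: "finite (set_pmf (beta_model n \<mu>))"
  by (rule finite_subset[of _ "Pow (vertex_pairs n)"])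
    (auto simp: beta_model_def finite_vertex_pairs)

lemma integrable_beta_model:
  "integrable (measure_pmf (beta_model n \<mu>)) (f :: _ \<Rightarrow> real)"
  by (rule integrable_measure_pmf_finite[OF finite_set_beta_model])

text \<open>The indicator is a product of factors, one for each vertex pair and depending on that
  pair alone; the factors outside \<open>S\<close> are constantly 1. Independence turns the
  expectation into the product of the Bernoulli expectations.\<close>

lemma expectation_subset_beta_model:
  assumes pos: "\<And>i. i \<in> {1..n} \<Longrightarrow> \<mu> i > 0" and S: "S \<subseteq> vertex_pairs n"
  shows "measure_pmf.expectation (beta_model n \<mu>) (\<lambda>G. of_bool (S \<subseteq> G)) = (\<Prod>e \<in> S. pair_prob \<mu> e)"
proof -
  let ?V = "vertex_pairs n"
  let ?f = "\<lambda>e b. of_bool (e \<in> S \<longrightarrow> b) :: real"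
  have "of_bool (S \<subseteq> {e \<in> ?V. h e}) = (\<Prod>e \<in> ?V. ?f e (h e))" for h
  proof (cases "S \<subseteq> {e \<in> ?V. h e}")
    case True
    then show ?thesis
      by (auto intro!: prod.neutral)
  next
    \<comment> \<open>Some pair of \<open>S\<close> is absent. As \<open>S\<close> consists of
      vertex pairs, its factor, which is 0, does occur in the product.\<close>
    case False
    then show ?thesis
      using S by (auto simp: finite_vertex_pairs intro!: prod_zero[symmetric])
  qed
  then have "measure_pmf.expectation (beta_model n \<mu>) (\<lambda>G. of_bool (S \<subseteq> G)) =
      measure_pmf.expectation (Pi_pmf ?V False (\<lambda>e. bernoulli_pmf (pair_prob \<mu> e)))
        (\<lambda>h. \<Prod>e \<in> ?V. ?f e (h e))"
    by (simp add: beta_model_def pair_prob_def)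
  also have "\<dots> = (\<Prod>e \<in> ?V. measure_pmf.expectation (bernoulli_pmf (pair_prob \<mu> e)) (?f e))"
    by (rule expectation_prod_Pi_pmf)
      (auto simp: finite_vertex_pairs intro: integrable_measure_pmf_finite)
  also have "\<dots> = (\<Prod>e \<in> ?V. if e \<in> S then pair_prob \<mu> e else 1)"
    by (rule prod.cong[OF refl], subst integral_bernoulli_pmf)
      (auto intro: pair_prob_bounds[OF pos])
  also have "\<dots> = (\<Prod>e \<in> S. pair_prob \<mu> e)"
    using S by (simp add: prod.If_cases finite_vertex_pairs Int_absorb1)
  finally show ?thesis .
qed

lemma expectation_triangle_count:
  assumes pos: "\<And>i. i \<in> {1..n} \<Longrightarrow> \<mu> i > 0"
  shows "measure_pmf.expectation (beta_model n \<mu>) (triangle_count n) =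
    (\<Sum>A \<in> nsets {1..n} 3. \<Prod>e \<in> nsets A 2. pair_prob \<mu> e)"
proof -
  have "measure_pmf.expectation (beta_model n \<mu>) (triangle_count n) =
    (\<Sum>A \<in> nsets {1..n} 3. measure_pmf.expectation (beta_model n \<mu>) (\<lambda>G. of_bool (nsets A 2 \<subseteq> G)))"
    unfolding triangle_count_eq[abs_def] by (rule Bochner_Integration.integral_sum) (rule integrable_beta_model)
  also have "\<dots> = (\<Sum>A \<in> nsets {1..n} 3. \<Prod>e \<in> nsets A 2. pair_prob \<mu> e)"
    by (intro sum.cong refl expectation_subset_beta_model[OF pos])
      (auto simp: vertex_pairs_eq nsets_def)
  finally show ?thesis .
qed

text \<open>The value \<open>c A B\<close> is the covariance of the indicators of \<open>A\<close>
  and \<open>B\<close>. If \<open>A\<close> and \<open>B\<close> share fewer than two vertices,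
  their edge sets are disjoint, so the product over the union splits and \<open>c A B\<close>
  vanishes. This leaves \<open>B = A\<close> and the sets meeting in exactly two vertices.\<close>

lemma variance_triangle_count:
  fixes n \<mu>
  defines "c \<equiv> \<lambda>A B. (\<Prod>e \<in> nsets A 2 \<union> nsets B 2. pair_prob \<mu> e) -
    (\<Prod>e \<in> nsets A 2. pair_prob \<mu> e) * (\<Prod>e \<in> nsets B 2. pair_prob \<mu> e)"
  assumes pos: "\<And>i. i \<in> {1..n} \<Longrightarrow> \<mu> i > 0"
  shows "measure_pmf.variance (beta_model n \<mu>) (triangle_count n) =
    (\<Sum>A \<in> nsets {1..n} 3. c A A) +
    (\<Sum>A \<in> nsets {1..n} 3. \<Sum>B \<in> {B \<in> nsets {1..n} 3. card (A \<inter> B) = 2}. c A B)"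
proof -
  let ?N = "nsets {1..n} 3" and ?E = "measure_pmf.expectation (beta_model n \<mu>)"
  have fin: "finite ?N"
    by (simp add: finite_imp_finite_nsets)
  have "?E (\<lambda>G. (triangle_count n G)\<^sup>2) =
      ?E (\<lambda>G. \<Sum>A \<in> ?N. \<Sum>B \<in> ?N. of_bool (nsets A 2 \<union> nsets B 2 \<subseteq> G))"
    by (simp add: triangle_count_eq power2_eq_square sum_product of_bool_conj)
  also have "\<dots> = (\<Sum>A \<in> ?N. \<Sum>B \<in> ?N. ?E (\<lambda>G. of_bool (nsets A 2 \<union> nsets B 2 \<subseteq> G)))"
    by (simp only: Bochner_Integration.integral_sum integrable_beta_model)
  also have "\<dots> = (\<Sum>A \<in> ?N. \<Sum>B \<in> ?N. \<Prod>e \<in> nsets A 2 \<union> nsets B 2. pair_prob \<mu> e)"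
    by (intro sum.cong refl expectation_subset_beta_model[OF pos])
      (auto simp: vertex_pairs_eq nsets_def)
  finally have square: "?E (\<lambda>G. (triangle_count n G)\<^sup>2) =
      (\<Sum>A \<in> ?N. \<Sum>B \<in> ?N. \<Prod>e \<in> nsets A 2 \<union> nsets B 2. pair_prob \<mu> e)" .
  have mean: "?E (triangle_count n) = (\<Sum>A \<in> ?N. \<Prod>e \<in> nsets A 2. pair_prob \<mu> e)"
    by (rule expectation_triangle_count) (rule pos)
  have "measure_pmf.variance (beta_model n \<mu>) (triangle_count n) =
      ?E (\<lambda>G. (triangle_count n G)\<^sup>2) - (?E (triangle_count n))\<^sup>2"
    by (rule measure_pmf.variance_eq[OF integrable_beta_model integrable_beta_model])
  also have "\<dots> = (\<Sum>A \<in> ?N. \<Sum>B \<in> ?N. c A B)"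
    unfolding mean square unfolding power2_eq_square sum_product c_def sum_subtractf ..
  also have "\<dots> = (\<Sum>A \<in> ?N. c A A + (\<Sum>B \<in> {B \<in> ?N. card (A \<inter> B) = 2}. c A B))"
  proof (rule sum.cong[OF refl])
    fix A assume A: "A \<in> ?N"
    have "c A B = 0" if "B \<in> ?N" "B \<noteq> A" "card (A \<inter> B) \<noteq> 2" for B
    proof -
      have finA: "finite A" "card A = 3" and finB: "finite B" "card B = 3"
        using A that by (auto simp: nsets_def)
      \<comment> \<open>Equality would give \<open>A \<subseteq> B\<close>, hence
        \<open>A = B\<close> since both have three elements.\<close>
      have "A \<inter> B \<subset> A"
        using that finA finB by (metis Int_lower1 card_subset_eq inf.absorb_iff1 psubsetI)
      then have "card (A \<inter> B) < 3"
        using finA psubset_card_mono by metis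
      with that have "card (A \<inter> B) < 2"
        by simp
      then have "nsets A 2 \<inter> nsets B 2 = {}"
        using finA unfolding nsets_Int by (simp add: nsets_eq_empty)
      then show ?thesis
        by (simp add: c_def prod.union_disjoint finA finB finite_imp_finite_nsets)
    qed
    then have "(\<Sum>B \<in> ?N. c A B) = (\<Sum>B \<in> insert A {B \<in> ?N. card (A \<inter> B) = 2}. c A B)"
      using fin A by (intro sum.mono_neutral_right) auto
    also have "\<dots> = c A A + (\<Sum>B \<in> {B \<in> ?N. card (A \<inter> B) = 2}. c A B)"
      using fin A by (subst sum.insert) (auto simp: nsets_def)
    finally show "(\<Sum>B \<in> ?N. c A B) = c A A + (\<Sum>B \<in> {B \<in> ?N. card (A \<inter> B) = 2}. c A B)" .
  qed
  finally show ?thesis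
    by (simp add: sum.distrib)
qed

section \<open>Sums over distinct indices against unrestricted sums\<close>

text \<open>A union bound: for nonnegative \<open>f\<close>, overlaps and a non-injective
  \<open>h\<close> only increase the right-hand side. It is used with \<open>h\<close> parametrizing
  a diagonal.\<close>

lemma sum_Un_image_le:
  fixes f :: "'b \<Rightarrow> real"
  assumes "finite T" "finite Y" "\<And>x. 0 \<le> f x"
  shows "sum f (T \<union> h ` Y) \<le> sum f T + (\<Sum>y \<in> Y. f (h y))"
proof -
  have "sum f (T \<union> h ` Y) + sum f (T \<inter> h ` Y) = sum f T + sum f (h ` Y)"
    using assms by (intro sum.union_inter) auto
  moreover have "0 \<le> sum f (T \<inter> h ` Y)"
    using assms by (simp add: sum_nonneg)
  moreover have "sum f (h ` Y) \<le> (\<Sum>y \<in> Y. f (h y))"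
    using sum_image_le[of Y f h] assms by simp
  ultimately show ?thesis
    by linarith
qed

lemma sum_times_product:
  fixes f g :: "_ \<Rightarrow> real"
  shows "(\<Sum>(x, y) \<in> A \<times> B. f x * g y) = sum f A * sum g B"
  by (simp add: sum_product sum.cartesian_product)

lemma sum_times_product3:
  fixes f g h :: "_ \<Rightarrow> real"
  shows "(\<Sum>(x, y, z) \<in> A \<times> B \<times> C. f x * g y * h z) = sum f A * sum g B * sum h C"
  using sum_times_product[of f "\<lambda>(y, z). g y * h z" A "B \<times> C"] sum_times_product[of g h B C]
  by (simp add: case_prod_unfold mult.assoc)

lemma sum_times_product4:
  fixes f g h u :: "_ \<Rightarrow> real"
  shows "(\<Sum>(x, y, z, t) \<in> A \<times> B \<times> C \<times> D. f x * g y * h z * u t) =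
    sum f A * sum g B * sum h C * sum u D"
  using sum_times_product[of f "\<lambda>(y, z, t). g y * h z * u t" A "B \<times> C \<times> D"]
    sum_times_product3[of g h u B C D]
  by (simp add: case_prod_unfold mult.assoc)

text \<open>A triple with a repetition lies on one of three diagonals. There one of the two equal
  weights is replaced by its bound \<open>d\<close>, which leaves the unrestricted sum over two
  indices.\<close>

lemma sum_triples_bounds:
  fixes a :: "'a \<Rightarrow> real"
  assumes fin: "finite V" and nonneg: "\<And>i. 0 \<le> a i" and le: "\<And>i. i \<in> V \<Longrightarrow> a i \<le> d"
  shows "(\<Sum>(i, j, k) \<in> triples V. a i * a j * a k) \<le> sum a V ^ 3"
    and "sum a V ^ 3 - 3 * d * sum a V ^ 2 \<le> (\<Sum>(i, j, k) \<in> triples V. a i * a j * a k)"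
proof -
  let ?f = "\<lambda>(i, j, k). a i * a j * a k"
  have f: "0 \<le> ?f x" for x
    by (auto simp: nonneg split: prod.split)
  have full: "sum ?f (V \<times> V \<times> V) = sum a V ^ 3"
    by (simp add: sum_times_product3 power3_eq_cube)
  have "sum ?f (triples V) \<le> sum ?f (V \<times> V \<times> V)"
    using fin f by (intro sum_mono2) (auto simp: triples_def)
  then show "sum ?f (triples V) \<le> sum a V ^ 3"
    unfolding full .
  let ?h1 = "\<lambda>(i, k). (i, i, k)" and ?h2 = "\<lambda>(i, k). (i, k, k)" and ?h3 = "\<lambda>(i, k). (i, k, i)"
  have diag: "(\<Sum>y \<in> V \<times> V. ?f (h y)) \<le> d * sum a V ^ 2"
    if h: "\<And>i k. i \<in> V \<Longrightarrow> k \<in> V \<Longrightarrow> ?f (h (i, k)) \<le> d * (a i * a k)" for h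
  proof -
    have "(\<Sum>y \<in> V \<times> V. ?f (h y)) \<le> (\<Sum>y \<in> V \<times> V. d * (case y of (i, k) \<Rightarrow> a i * a k))"
      by (rule sum_mono) (auto simp: h)
    also have "\<dots> = d * sum a V ^ 2"
      by (simp only: sum_distrib_left[symmetric] sum_times_product power2_eq_square)
    finally show ?thesis .
  qed
  have h1: "a i * a i * a k \<le> d * (a i * a k)" "a k * a i * a i \<le> d * (a k * a i)"
    "a i * a k * a i \<le> d * (a i * a k)" if "i \<in> V" for i k
    using mult_right_mono[OF le[OF that], of "a i * a k"] nonneg by (simp_all add: mult_ac)
  have "sum ?f (V \<times> V \<times> V) \<le>
      sum ?f (triples V \<union> ?h1 ` (V \<times> V) \<union> ?h2 ` (V \<times> V) \<union> ?h3 ` (V \<times> V))"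
    using fin f by (intro sum_mono2 finite_UnI finite_imageI finite_triples)
      (auto simp: triples_def image_iff)
  also have "\<dots> \<le> sum ?f (triples V) + (\<Sum>y \<in> V \<times> V. ?f (?h1 y)) +
      (\<Sum>y \<in> V \<times> V. ?f (?h2 y)) + (\<Sum>y \<in> V \<times> V. ?f (?h3 y))"
    using fin f
    by (intro order_trans[OF sum_Un_image_le] add_right_mono order_refl finite_UnI finite_imageI)
      (auto simp: finite_triples)
  also have "\<dots> \<le> sum ?f (triples V) + d * sum a V ^ 2 + d * sum a V ^ 2 + d * sum a V ^ 2"
    using h1 by (intro add_mono order_refl diag) auto
  finally show "sum a V ^ 3 - 3 * d * sum a V ^ 2 \<le> sum ?f (triples V)"
    unfolding full by simp
qed

text \<open>Six diagonals cover the tuples with a repetition. On \<open>i = j\<close> the square of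
  the \<open>b\<close>-weight is traded for \<open>d ^ 2\<close> times an \<open>a\<close>-weight,
  leaving three free \<open>a\<close>-weights. Each of the other five involves \<open>k\<close> or
  \<open>l\<close>, whose \<open>a\<close>-weight is bounded by \<open>d\<close>, leaving two
  \<open>b\<close>-weights and one \<open>a\<close>-weight.\<close>

lemma sum_quadruples_bounds:
  fixes a b :: "'a \<Rightarrow> real"
  assumes fin: "finite V" and nonneg: "\<And>i. 0 \<le> a i" "\<And>i. 0 \<le> b i"
    and le: "\<And>i. i \<in> V \<Longrightarrow> a i \<le> d" "\<And>i. i \<in> V \<Longrightarrow> b i * b i \<le> d ^ 2 * a i"
  shows "(\<Sum>(i, j, k, l) \<in> quadruples V. b i * b j * a k * a l) \<le> sum b V ^ 2 * sum a V ^ 2"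
    and "sum b V ^ 2 * sum a V ^ 2 - d ^ 2 * sum a V ^ 3 - 5 * d * sum b V ^ 2 * sum a V
      \<le> (\<Sum>(i, j, k, l) \<in> quadruples V. b i * b j * a k * a l)"
proof -
  let ?f = "\<lambda>(i, j, k, l). b i * b j * a k * a l" and ?V = "V \<times> V \<times> V"
  have f: "0 \<le> ?f x" for x
    by (auto simp: nonneg split: prod.split)
  have full: "sum ?f (V \<times> ?V) = sum b V ^ 2 * sum a V ^ 2"
    by (simp add: sum_times_product4 power2_eq_square)
  have "sum ?f (quadruples V) \<le> sum ?f (V \<times> ?V)"
    using fin f by (intro sum_mono2) (auto simp: quadruples_def)
  then show "sum ?f (quadruples V) \<le> sum b V ^ 2 * sum a V ^ 2"
    unfolding full .
  let ?h0 = "\<lambda>(i, k, l). (i, i, k, l)" and ?h1 = "\<lambda>(i, j, k). (i, j, k, k)"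
    and ?h2 = "\<lambda>(i, j, k). (i, j, i, k)" and ?h3 = "\<lambda>(i, j, k). (i, j, j, k)"
    and ?h4 = "\<lambda>(i, j, k). (i, j, k, i)" and ?h5 = "\<lambda>(i, j, k). (i, j, k, j)"
  have "(\<Sum>y \<in> ?V. ?f (?h0 y)) \<le> (\<Sum>y \<in> ?V. d ^ 2 * (case y of (i, k, l) \<Rightarrow> a i * a k * a l))"
  proof (rule sum_mono, clarify)
    fix i k l assume "i \<in> V"
    then show "b i * b i * a k * a l \<le> d ^ 2 * (a i * a k * a l)"
      using mult_right_mono[OF le(2), of i "a k * a l"] nonneg by (simp add: mult_ac)
  qed
  also have "\<dots> = d ^ 2 * sum a V ^ 3"
    by (simp only: sum_distrib_left[symmetric] sum_times_product3 power3_eq_cube)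
  finally have diag0: "(\<Sum>y \<in> ?V. ?f (?h0 y)) \<le> d ^ 2 * sum a V ^ 3" .
  have diag: "(\<Sum>y \<in> ?V. ?f (h y)) \<le> d * sum b V ^ 2 * sum a V"
    if h: "\<And>i j k. i \<in> V \<Longrightarrow> j \<in> V \<Longrightarrow> k \<in> V \<Longrightarrow> ?f (h (i, j, k)) \<le> d * (b i * b j * a k)" for h
  proof -
    have "(\<Sum>y \<in> ?V. ?f (h y)) \<le> (\<Sum>y \<in> ?V. d * (case y of (i, j, k) \<Rightarrow> b i * b j * a k))"
      by (rule sum_mono) (auto simp: h)
    also have "\<dots> = d * sum b V ^ 2 * sum a V"
      by (simp only: sum_distrib_left[symmetric] sum_times_product3 power2_eq_square mult.assoc[symmetric])
    finally show ?thesis .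
  qed
  \<comment> \<open>The two forms serve diagonals on which the factor to be bounded stands third or
    last.\<close>
  have h1: "b i * b j * a k * a l \<le> d * (b i * b j * a l)" "b i * b j * a l * a k \<le> d * (b i * b j * a l)"
    if "k \<in> V" for i j k l
    using mult_right_mono[OF le(1)[OF that], of "b i * b j * a l"] nonneg by (simp_all add: mult_ac)
  have "sum ?f (V \<times> ?V) \<le> sum ?f (quadruples V \<union> ?h0 ` ?V \<union> ?h1 ` ?V \<union> ?h2 ` ?V \<union> ?h3 ` ?V \<union>
      ?h4 ` ?V \<union> ?h5 ` ?V)"
    using fin f by (intro sum_mono2 finite_UnI finite_imageI finite_quadruples)
      (auto simp: quadruples_def image_iff)
  also have "\<dots> \<le> sum ?f (quadruples V) + (\<Sum>y \<in> ?V. ?f (?h0 y)) + (\<Sum>y \<in> ?V. ?f (?h1 y)) +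
      (\<Sum>y \<in> ?V. ?f (?h2 y)) + (\<Sum>y \<in> ?V. ?f (?h3 y)) + (\<Sum>y \<in> ?V. ?f (?h4 y)) +
      (\<Sum>y \<in> ?V. ?f (?h5 y))"
    using fin f
    by (intro order_trans[OF sum_Un_image_le] add_right_mono order_refl finite_UnI finite_imageI)
      (auto simp: finite_quadruples)
  also have "\<dots> \<le> sum ?f (quadruples V) + d ^ 2 * sum a V ^ 3 + d * sum b V ^ 2 * sum a V +
      d * sum b V ^ 2 * sum a V + d * sum b V ^ 2 * sum a V + d * sum b V ^ 2 * sum a V +
      d * sum b V ^ 2 * sum a V"
    using h1 by (intro add_mono order_refl diag diag0) auto
  finally show "sum b V ^ 2 * sum a V ^ 2 - d ^ 2 * sum a V ^ 3 - 5 * d * sum b V ^ 2 * sum a V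
      \<le> sum ?f (quadruples V)"
    unfolding full by (simp add: algebra_simps)
qed

section \<open>Moment bounds for a fixed number of vertices\<close>

lemma prod_pair_prob_triple:
  assumes "distinct [i, j, k]"
  shows "(\<Prod>e \<in> nsets {i, j, k} 2. pair_prob \<mu> e) =
    edge_prob \<mu> i j * edge_prob \<mu> j k * edge_prob \<mu> k i"
  using assms by (simp add: nsets_2_triple doubleton_eq_iff pair_prob_pair mult.assoc)

text \<open>The pair \<open>{i, j}\<close> belongs to both triangles and enters the union once, so
  five factors remain instead of six.\<close>

lemma prod_pair_prob_adjacent_triples:
  assumes "distinct [i, j, k, l]"
  shows "(\<Prod>e \<in> nsets {i, j, k} 2 \<union> nsets {i, j, l} 2. pair_prob \<mu> e) =
    edge_prob \<mu> i j * edge_prob \<mu> j k * edge_prob \<mu> k i * edge_prob \<mu> j l * edge_prob \<mu> l i"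
proof -
  have "nsets {i, j, k} 2 \<union> nsets {i, j, l} 2 = {{i, j}, {j, k}, {k, i}, {j, l}, {l, i}}"
    using assms by (simp add: nsets_2_triple insert_commute)
  then show ?thesis
    using assms by (simp add: doubleton_eq_iff pair_prob_pair mult.assoc)
qed

text \<open>The bound \<open>m\<close> is later instantiated with \<open>vec_max\<close>. Its square
  \<open>d\<close> bounds all \<open>\<mu> i * \<mu> j\<close> and thereby all edge probabilities.
  The absolute values keep the power sums in the form that occurs in
  \<open>vec_norm\<close>.\<close>

context
  fixes n :: nat and \<mu> :: "nat \<Rightarrow> real" and m d S2 S3 :: real
  assumes pos: "\<And>i. i \<in> {1..n} \<Longrightarrow> \<mu> i > 0"
    and le_m: "\<And>i. i \<in> {1..n} \<Longrightarrow> \<mu> i \<le> m"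
    and m: "0 \<le> m" "m \<le> 1"
  defines "d \<equiv> m ^ 2"
    and "S2 \<equiv> (\<Sum>i = 1..n. \<bar>\<mu> i\<bar> ^ 2)"
    and "S3 \<equiv> (\<Sum>i = 1..n. \<bar>\<mu> i\<bar> ^ 3)"
begin

lemma d_bounds: "0 \<le> d" "d \<le> 1"
  using m by (auto simp: d_def power_le_one)

lemma edge_prob_le_d:
  assumes "i \<in> {1..n}" "j \<in> {1..n}"
  shows "\<mu> i * \<mu> j \<le> d" "0 \<le> edge_prob \<mu> i j" "edge_prob \<mu> i j \<le> \<mu> i * \<mu> j"
    "(1 - d) * (\<mu> i * \<mu> j) \<le> edge_prob \<mu> i j" "1 - d \<le> 1 - edge_prob \<mu> i j"
proof -
  show le: "\<mu> i * \<mu> j \<le> d"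
    unfolding d_def power2_eq_square using assms pos le_m m
    by (intro mult_mono) (auto intro: less_imp_le)
  show "0 \<le> edge_prob \<mu> i j" "(1 - d) * (\<mu> i * \<mu> j) \<le> edge_prob \<mu> i j"
    and le': "edge_prob \<mu> i j \<le> \<mu> i * \<mu> j"
    using edge_prob_bounds(1,3)[of \<mu> i j] edge_prob_bounds(4)[of \<mu> i j d] assms pos le by auto
  show "1 - d \<le> 1 - edge_prob \<mu> i j"
    using le le' by simp
qed

lemma square_weight_le: "i \<in> {1..n} \<Longrightarrow> \<bar>\<mu> i\<bar> ^ 2 \<le> d"
  using edge_prob_le_d(1)[of i i] by (simp add: power2_eq_square)

text \<open>The sixth power is the cube of \<open>\<bar>\<mu> i\<bar> ^ 2\<close>, and two of these
  three factors are at most \<open>d\<close>. This is the condition on \<open>b\<close> in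
  \<open>sum_quadruples_bounds\<close>.\<close>

lemma cube_weight_le:
  assumes "i \<in> {1..n}"
  shows "\<bar>\<mu> i\<bar> ^ 3 * \<bar>\<mu> i\<bar> ^ 3 \<le> d ^ 2 * \<bar>\<mu> i\<bar> ^ 2"
proof -
  have "(\<bar>\<mu> i\<bar> ^ 2) ^ 2 * \<bar>\<mu> i\<bar> ^ 2 \<le> d ^ 2 * \<bar>\<mu> i\<bar> ^ 2"
    using square_weight_le[OF assms] by (intro mult_right_mono power_mono) auto
  then show ?thesis
    by (simp only: power_mult[symmetric] power_add[symmetric]) simp
qed

lemma weighted_triples:
  "(\<Sum>(i, j, k) \<in> triples {1..n}. \<bar>\<mu> i\<bar> ^ 2 * \<bar>\<mu> j\<bar> ^ 2 * \<bar>\<mu> k\<bar> ^ 2) \<le> S2 ^ 3"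
  "S2 ^ 3 - 3 * d * S2 ^ 2 \<le> (\<Sum>(i, j, k) \<in> triples {1..n}. \<bar>\<mu> i\<bar> ^ 2 * \<bar>\<mu> j\<bar> ^ 2 * \<bar>\<mu> k\<bar> ^ 2)"
  unfolding S2_def
  by (rule sum_triples_bounds[of _ "\<lambda>i. \<bar>\<mu> i\<bar> ^ 2" d];
      (rule finite_atLeastAtMost zero_le_power2 | erule square_weight_le))+

lemma weighted_quadruples:
  "(\<Sum>(i, j, k, l) \<in> quadruples {1..n}. \<bar>\<mu> i\<bar> ^ 3 * \<bar>\<mu> j\<bar> ^ 3 * \<bar>\<mu> k\<bar> ^ 2 * \<bar>\<mu> l\<bar> ^ 2)
    \<le> S3 ^ 2 * S2 ^ 2"
  "S3 ^ 2 * S2 ^ 2 - d ^ 2 * S2 ^ 3 - 5 * d * S3 ^ 2 * S2 \<le>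
    (\<Sum>(i, j, k, l) \<in> quadruples {1..n}. \<bar>\<mu> i\<bar> ^ 3 * \<bar>\<mu> j\<bar> ^ 3 * \<bar>\<mu> k\<bar> ^ 2 * \<bar>\<mu> l\<bar> ^ 2)"
  unfolding S2_def S3_def
  by (rule sum_quadruples_bounds[of _ "\<lambda>i. \<bar>\<mu> i\<bar> ^ 2" "\<lambda>i. \<bar>\<mu> i\<bar> ^ 3" d];
      (rule finite_atLeastAtMost zero_le_power2 zero_le_power abs_ge_zero
        | erule square_weight_le cube_weight_le)+)+

text \<open>Each vertex lies on two of the three edges, whence the squares; each edge costs one
  factor \<open>1 - d\<close> from below. The bound by \<open>d\<close> keeps one edge probability
  and estimates the others by 1; it serves to bound \<open>1 - P\<close> from below.\<close>

lemma prod_triple_bounds: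
  assumes "(i, j, k) \<in> triples {1..n}"
  shows "(1 - d) ^ 3 * (\<bar>\<mu> i\<bar> ^ 2 * \<bar>\<mu> j\<bar> ^ 2 * \<bar>\<mu> k\<bar> ^ 2)
      \<le> edge_prob \<mu> i j * edge_prob \<mu> j k * edge_prob \<mu> k i" (is "?L \<le> ?P")
    and "edge_prob \<mu> i j * edge_prob \<mu> j k * edge_prob \<mu> k i
      \<le> \<bar>\<mu> i\<bar> ^ 2 * \<bar>\<mu> j\<bar> ^ 2 * \<bar>\<mu> k\<bar> ^ 2" (is "_ \<le> ?U")
    and "edge_prob \<mu> i j * edge_prob \<mu> j k * edge_prob \<mu> k i \<le> d"
proof -
  have V: "i \<in> {1..n}" "j \<in> {1..n}" "k \<in> {1..n}"
    using assms by (auto simp: triples_def)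
  note p = edge_prob_le_d[OF V(1,2)] edge_prob_le_d[OF V(2,3)] edge_prob_le_d[OF V(3,1)]
  have w: "0 < \<mu> i" "0 < \<mu> j" "0 < \<mu> k"
    using V pos by auto
  have "?L = (1 - d) * (\<mu> i * \<mu> j) * ((1 - d) * (\<mu> j * \<mu> k)) * ((1 - d) * (\<mu> k * \<mu> i))"
    using w by (simp add: power2_eq_square power3_eq_cube)
  also have "\<dots> \<le> ?P"
    using p w d_bounds by (intro mult_mono mult_nonneg_nonneg) auto
  finally show "?L \<le> ?P" .
  have "?P \<le> (\<mu> i * \<mu> j) * (\<mu> j * \<mu> k) * (\<mu> k * \<mu> i)"
    using p w by (intro mult_mono mult_nonneg_nonneg) auto
  also have "\<dots> = ?U"
    using w by (simp add: power2_eq_square)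
  finally show "?P \<le> ?U" .
  have "?P \<le> d * 1 * 1"
    using p d_bounds by (intro mult_mono mult_nonneg_nonneg) auto
  then show "?P \<le> d"
    by simp
qed

lemma variance_triple_bounds:
  assumes "(i, j, k) \<in> triples {1..n}"
  defines "P \<equiv> edge_prob \<mu> i j * edge_prob \<mu> j k * edge_prob \<mu> k i"
  shows "(1 - d) ^ 6 * (\<bar>\<mu> i\<bar> ^ 2 * \<bar>\<mu> j\<bar> ^ 2 * \<bar>\<mu> k\<bar> ^ 2) \<le> P - P * P" (is "_ * ?U \<le> _")
    and "P - P * P \<le> \<bar>\<mu> i\<bar> ^ 2 * \<bar>\<mu> j\<bar> ^ 2 * \<bar>\<mu> k\<bar> ^ 2"
proof -
  note P = prod_triple_bounds[OF assms(1), folded P_def]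
  have "0 \<le> (1 - d) ^ 3 * ?U"
    using d_bounds by simp
  then have "0 \<le> P"
    using P(1) by simp
  \<comment> \<open>Three factors \<open>1 - d\<close> come from \<open>P\<close> and one from
    \<open>1 - P\<close>. The exponent is raised from 4 to 6 so that the covariances can share the
    same prefactor.\<close>
  have "(1 - d) ^ 6 * ?U \<le> (1 - d) ^ 4 * ?U"
    using d_bounds by (intro mult_right_mono power_decreasing) auto
  also have "\<dots> = (1 - d) ^ 3 * ?U * (1 - d)"
    by (simp add: eval_nat_numeral)
  also have "\<dots> \<le> P * (1 - P)"
    using P d_bounds \<open>0 \<le> P\<close> by (intro mult_mono) auto
  finally show "(1 - d) ^ 6 * ?U \<le> P - P * P"
    by (simp add: algebra_simps)
  show "P - P * P \<le> ?U"
    using P(2) zero_le_square[of P] by linarith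
qed

text \<open>Factoring out the five edges leaves \<open>1 - edge_prob \<mu> i j\<close>. The vertices
  \<open>i\<close> and \<open>j\<close> lie on three of these edges, \<open>k\<close> and
  \<open>l\<close> on two, which gives the exponents 3 and 2. The five edges and the last factor
  cost one \<open>1 - d\<close> each.\<close>

lemma covariance_quadruple_bounds:
  assumes "(i, j, k, l) \<in> quadruples {1..n}"
  defines "c \<equiv> edge_prob \<mu> i j * edge_prob \<mu> j k * edge_prob \<mu> k i * edge_prob \<mu> j l * edge_prob \<mu> l i -
    edge_prob \<mu> i j * edge_prob \<mu> j k * edge_prob \<mu> k i *
    (edge_prob \<mu> i j * edge_prob \<mu> j l * edge_prob \<mu> l i)"
  shows "(1 - d) ^ 6 * (\<bar>\<mu> i\<bar> ^ 3 * \<bar>\<mu> j\<bar> ^ 3 * \<bar>\<mu> k\<bar> ^ 2 * \<bar>\<mu> l\<bar> ^ 2) \<le> c" (is "?L \<le> _")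
    and "c \<le> \<bar>\<mu> i\<bar> ^ 3 * \<bar>\<mu> j\<bar> ^ 3 * \<bar>\<mu> k\<bar> ^ 2 * \<bar>\<mu> l\<bar> ^ 2" (is "_ \<le> ?U")
proof -
  have V: "i \<in> {1..n}" "j \<in> {1..n}" "k \<in> {1..n}" "l \<in> {1..n}"
    using assms by (auto simp: quadruples_def)
  note p = edge_prob_le_d[OF V(1,2)] edge_prob_le_d[OF V(2,3)] edge_prob_le_d[OF V(3,1)]
    edge_prob_le_d[OF V(2,4)] edge_prob_le_d[OF V(4,1)]
  have w: "0 < \<mu> i" "0 < \<mu> j" "0 < \<mu> k" "0 < \<mu> l"
    using V pos by auto
  have c: "c = edge_prob \<mu> i j * edge_prob \<mu> j k * edge_prob \<mu> k i * edge_prob \<mu> j l *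
      edge_prob \<mu> l i * (1 - edge_prob \<mu> i j)"
    unfolding c_def by algebra
  have "?L = (1 - d) * (\<mu> i * \<mu> j) * ((1 - d) * (\<mu> j * \<mu> k)) * ((1 - d) * (\<mu> k * \<mu> i)) *
      ((1 - d) * (\<mu> j * \<mu> l)) * ((1 - d) * (\<mu> l * \<mu> i)) * (1 - d)"
    using w by (simp add: eval_nat_numeral mult_ac)
  also have "\<dots> \<le> c"
    unfolding c using p w d_bounds by (intro mult_mono mult_nonneg_nonneg) auto
  finally show "?L \<le> c" .
  have "c \<le> (\<mu> i * \<mu> j) * (\<mu> j * \<mu> k) * (\<mu> k * \<mu> i) * (\<mu> j * \<mu> l) * (\<mu> l * \<mu> i) * 1"
    unfolding c using p w d_bounds by (intro mult_mono mult_nonneg_nonneg) auto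
  also have "\<dots> = ?U"
    using w by (simp add: eval_nat_numeral mult_ac)
  finally show "c \<le> ?U" .
qed

lemma expectation_bounds:
  shows "measure_pmf.expectation (beta_model n \<mu>) (triangle_count n) \<le> S2 ^ 3 / 6"
    and "(1 - d) ^ 3 * (S2 ^ 3 - 3 * d * S2 ^ 2) / 6
      \<le> measure_pmf.expectation (beta_model n \<mu>) (triangle_count n)"
proof -
  let ?P = "\<lambda>(i, j, k). edge_prob \<mu> i j * edge_prob \<mu> j k * edge_prob \<mu> k i"
    and ?U = "\<lambda>(i, j, k). \<bar>\<mu> i\<bar> ^ 2 * \<bar>\<mu> j\<bar> ^ 2 * \<bar>\<mu> k\<bar> ^ 2" and ?T = "triples {1..n}"
  have "6 * measure_pmf.expectation (beta_model n \<mu>) (triangle_count n) =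
      (\<Sum>(i, j, k) \<in> ?T. \<Prod>e \<in> nsets {i, j, k} 2. pair_prob \<mu> e)"
    using expectation_triangle_count[of n \<mu>, OF pos]
      sum_triples_eq[of "{1..n}" "\<lambda>A. \<Prod>e \<in> nsets A 2. pair_prob \<mu> e"] by simp
  also have "\<dots> = sum ?P ?T"
    by (rule sum.cong) (auto simp: triples_def prod_pair_prob_triple)
  finally have E: "6 * measure_pmf.expectation (beta_model n \<mu>) (triangle_count n) = sum ?P ?T" .
  have "sum ?P ?T \<le> sum ?U ?T"
    by (rule sum_mono, clarify, erule prod_triple_bounds)
  also have "\<dots> \<le> S2 ^ 3"
    by (rule weighted_triples(1))
  finally show "measure_pmf.expectation (beta_model n \<mu>) (triangle_count n) \<le> S2 ^ 3 / 6"
    using E by simp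
  have "(1 - d) ^ 3 * (S2 ^ 3 - 3 * d * S2 ^ 2) \<le> (1 - d) ^ 3 * sum ?U ?T"
    using d_bounds
    by (intro mult_left_mono weighted_triples(2)) simp
  also have "\<dots> \<le> sum ?P ?T"
    unfolding sum_distrib_left by (rule sum_mono, clarify, erule prod_triple_bounds)
  finally show "(1 - d) ^ 3 * (S2 ^ 3 - 3 * d * S2 ^ 2) / 6
      \<le> measure_pmf.expectation (beta_model n \<mu>) (triangle_count n)"
    using E by simp
qed

lemma variance_bounds:
  shows "measure_pmf.variance (beta_model n \<mu>) (triangle_count n) \<le> S2 ^ 3 / 6 + S3 ^ 2 * S2 ^ 2 / 2"
    and "(1 - d) ^ 6 * ((S2 ^ 3 - 3 * d * S2 ^ 2) / 6 +
        (S3 ^ 2 * S2 ^ 2 - d ^ 2 * S2 ^ 3 - 5 * d * S3 ^ 2 * S2) / 2)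
      \<le> measure_pmf.variance (beta_model n \<mu>) (triangle_count n)"
proof -
  define c where "c = (\<lambda>A B. (\<Prod>e \<in> nsets A 2 \<union> nsets B 2. pair_prob \<mu> e) -
    (\<Prod>e \<in> nsets A 2. pair_prob \<mu> e) * (\<Prod>e \<in> nsets B 2. pair_prob \<mu> e))"
  let ?T = "triples {1..n}" and ?Q = "quadruples {1..n}"
  let ?C = "\<lambda>(i, j, k). c {i, j, k} {i, j, k}"
    and ?D = "\<lambda>(i, j, k, l). c {i, j, k} {i, j, l}"
    and ?U = "\<lambda>(i, j, k). \<bar>\<mu> i\<bar> ^ 2 * \<bar>\<mu> j\<bar> ^ 2 * \<bar>\<mu> k\<bar> ^ 2"
    and ?W = "\<lambda>(i, j, k, l). \<bar>\<mu> i\<bar> ^ 3 * \<bar>\<mu> j\<bar> ^ 3 * \<bar>\<mu> k\<bar> ^ 2 * \<bar>\<mu> l\<bar> ^ 2"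
  have "measure_pmf.variance (beta_model n \<mu>) (triangle_count n) =
      (\<Sum>A \<in> nsets {1..n} 3. c A A) +
      (\<Sum>A \<in> nsets {1..n} 3. \<Sum>B \<in> {B \<in> nsets {1..n} 3. card (A \<inter> B) = 2}. c A B)"
    unfolding c_def by (rule variance_triangle_count) (rule pos)
  \<comment> \<open>The denominators 6 and 2 undo the multiplicities with which ordered tuples count
    sets and pairs of sets.\<close>
  then have V: "measure_pmf.variance (beta_model n \<mu>) (triangle_count n) =
      sum ?C ?T / 6 + sum ?D ?Q / 2"
    using sum_triples_eq[of "{1..n}" "\<lambda>A. c A A"] sum_quadruples_eq[of "{1..n}" c] by simp
  have C: "(1 - d) ^ 6 * ?U t \<le> ?C t" "?C t \<le> ?U t" if "t \<in> ?T" for t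
  proof -
    obtain i j k where t: "t = (i, j, k)"
      by (rule prod_cases3)
    with that have "distinct [i, j, k]"
      by (simp add: triples_def)
    with variance_triple_bounds that show "(1 - d) ^ 6 * ?U t \<le> ?C t" "?C t \<le> ?U t"
      unfolding t by (simp_all add: c_def prod_pair_prob_triple)
  qed
  have D: "(1 - d) ^ 6 * ?W t \<le> ?D t" "?D t \<le> ?W t" if "t \<in> ?Q" for t
  proof -
    obtain i j k l where t: "t = (i, j, k, l)"
      by (rule prod_cases4)
    with that have dist: "distinct [i, j, k, l]"
      by (simp add: quadruples_def)
    then have "distinct [i, j, k]" "distinct [i, j, l]"
      by auto
    with dist covariance_quadruple_bounds that show "(1 - d) ^ 6 * ?W t \<le> ?D t" "?D t \<le> ?W t"
      unfolding t by (simp_all only: prod.case c_def prod_pair_prob_triple prod_pair_prob_adjacent_triples)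
  qed
  have "sum ?C ?T \<le> sum ?U ?T"
    by (rule sum_mono) (rule C)
  also have "\<dots> \<le> S2 ^ 3"
    by (rule weighted_triples(1))
  finally have C_le: "sum ?C ?T \<le> S2 ^ 3" .
  have "sum ?D ?Q \<le> sum ?W ?Q"
    by (rule sum_mono) (rule D)
  also have "\<dots> \<le> S3 ^ 2 * S2 ^ 2"
    by (rule weighted_quadruples(1))
  finally show "measure_pmf.variance (beta_model n \<mu>) (triangle_count n) \<le>
      S2 ^ 3 / 6 + S3 ^ 2 * S2 ^ 2 / 2"
    unfolding V using C_le by simp
  have "(1 - d) ^ 6 * (S2 ^ 3 - 3 * d * S2 ^ 2) \<le> (1 - d) ^ 6 * sum ?U ?T"
    using d_bounds
    by (intro mult_left_mono weighted_triples(2)) simp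
  also have "\<dots> \<le> sum ?C ?T"
    unfolding sum_distrib_left by (rule sum_mono) (rule C)
  finally have C_ge: "(1 - d) ^ 6 * (S2 ^ 3 - 3 * d * S2 ^ 2) \<le> sum ?C ?T" .
  have "(1 - d) ^ 6 * (S3 ^ 2 * S2 ^ 2 - d ^ 2 * S2 ^ 3 - 5 * d * S3 ^ 2 * S2) \<le> (1 - d) ^ 6 * sum ?W ?Q"
    using d_bounds
    by (intro mult_left_mono weighted_quadruples(2)) simp
  also have "\<dots> \<le> sum ?D ?Q"
    unfolding sum_distrib_left by (rule sum_mono) (rule D)
  finally show "(1 - d) ^ 6 * ((S2 ^ 3 - 3 * d * S2 ^ 2) / 6 +
        (S3 ^ 2 * S2 ^ 2 - d ^ 2 * S2 ^ 3 - 5 * d * S3 ^ 2 * S2) / 2)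
      \<le> measure_pmf.variance (beta_model n \<mu>) (triangle_count n)"
    unfolding V using C_ge by (simp add: distrib_left)
qed

text \<open>Dividing by the main term leaves bounds that depend only on \<open>d\<close> and
  \<open>inverse S2\<close>, ready for a squeeze.\<close>

lemma expectation_ratio_bounds:
  assumes "S2 > 0"
  shows "(1 - d) ^ 3 * (1 - 3 * d * inverse S2)
      \<le> measure_pmf.expectation (beta_model n \<mu>) (triangle_count n) / (S2 ^ 3 / 6)"
    and "measure_pmf.expectation (beta_model n \<mu>) (triangle_count n) / (S2 ^ 3 / 6) \<le> 1"
proof -
  have "(1 - d) ^ 3 * (1 - 3 * d * inverse S2) * (S2 ^ 3 / 6) =
      (1 - d) ^ 3 * (S2 ^ 3 - 3 * d * S2 ^ 2) / 6"
    using assms by (simp add: field_simps eval_nat_numeral)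
  also note expectation_bounds(2)
  finally show "(1 - d) ^ 3 * (1 - 3 * d * inverse S2)
      \<le> measure_pmf.expectation (beta_model n \<mu>) (triangle_count n) / (S2 ^ 3 / 6)"
    using assms by (subst pos_le_divide_eq) simp_all
  show "measure_pmf.expectation (beta_model n \<mu>) (triangle_count n) / (S2 ^ 3 / 6) \<le> 1"
    using expectation_bounds(1) assms by (subst pos_divide_le_eq) auto
qed

text \<open>Each error is measured against a single summand of \<open>R\<close>: relative to
  \<open>S2 ^ 3 / 6\<close> the errors are \<open>3 * d * inverse S2\<close> and
  \<open>3 * d ^ 2\<close>, relative to \<open>S3 ^ 2 * S2 ^ 2 / 2\<close> the error is
  \<open>5 * d * inverse S2\<close>. With \<open>8 = 3 + 5\<close> the result holds whichever
  summand dominates.\<close>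

lemma variance_ratio_bounds:
  assumes "S2 > 0"
  defines "R \<equiv> S2 ^ 3 / 6 + S3 ^ 2 * S2 ^ 2 / 2"
  shows "(1 - d) ^ 6 * (1 - 8 * d * inverse S2 - 3 * d ^ 2)
      \<le> measure_pmf.variance (beta_model n \<mu>) (triangle_count n) / R"
    and "measure_pmf.variance (beta_model n \<mu>) (triangle_count n) / R \<le> 1"
proof -
  have R: "R > 0"
    using assms by (auto simp: R_def intro: add_pos_nonneg)
  \<comment> \<open>This is the surplus from charging all relative errors to both summands of
    \<open>R\<close>.\<close>
  have "0 \<le> 5 / 6 * d * S2 ^ 2 + 3 / 2 * d * S3 ^ 2 * S2 + 3 / 2 * d ^ 2 * S3 ^ 2 * S2 ^ 2"
    using assms(1) d_bounds by (intro add_nonneg_nonneg mult_nonneg_nonneg) auto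
  moreover have "(1 - 8 * d * inverse S2 - 3 * d ^ 2) * R =
      (S2 ^ 3 - 3 * d * S2 ^ 2) / 6 + (S3 ^ 2 * S2 ^ 2 - d ^ 2 * S2 ^ 3 - 5 * d * S3 ^ 2 * S2) / 2 -
      (5 / 6 * d * S2 ^ 2 + 3 / 2 * d * S3 ^ 2 * S2 + 3 / 2 * d ^ 2 * S3 ^ 2 * S2 ^ 2)"
    using assms(1) by (simp add: R_def field_simps eval_nat_numeral)
  ultimately have "(1 - 8 * d * inverse S2 - 3 * d ^ 2) * R \<le> (S2 ^ 3 - 3 * d * S2 ^ 2) / 6 +
      (S3 ^ 2 * S2 ^ 2 - d ^ 2 * S2 ^ 3 - 5 * d * S3 ^ 2 * S2) / 2"
    by linarith
  then have "(1 - d) ^ 6 * ((1 - 8 * d * inverse S2 - 3 * d ^ 2) * R) \<le>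
      (1 - d) ^ 6 * ((S2 ^ 3 - 3 * d * S2 ^ 2) / 6 +
        (S3 ^ 2 * S2 ^ 2 - d ^ 2 * S2 ^ 3 - 5 * d * S3 ^ 2 * S2) / 2)"
    using d_bounds by (intro mult_left_mono) auto
  also note variance_bounds(2)
  finally show "(1 - d) ^ 6 * (1 - 8 * d * inverse S2 - 3 * d ^ 2)
      \<le> measure_pmf.variance (beta_model n \<mu>) (triangle_count n) / R"
    using R by (subst pos_le_divide_eq) (auto simp: mult.assoc)
  show "measure_pmf.variance (beta_model n \<mu>) (triangle_count n) / R \<le> 1"
    using variance_bounds(1) R by (subst pos_divide_le_eq) (auto simp: R_def)
qed

end

section \<open>Norms as power sums, and the passage to the limit\<close>

lemma vec_norm_power:
  assumes "k > 0"
  shows "vec_norm (real k) n x ^ (k * r) = (\<Sum>i = 1..n. \<bar>x i\<bar> ^ k) ^ r"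
proof -
  have "(\<Sum>i = 1..n. \<bar>x i\<bar> powr real k) = (\<Sum>i = 1..n. \<bar>x i\<bar> ^ k)"
    \<comment> \<open>At a zero entry \<open>k > 0\<close> matters: \<open>0 powr 0\<close> is 0
      while \<open>0 ^ 0\<close> is 1.\<close>
    using assms by (intro sum.cong) (auto simp: powr_realpow')
  moreover have "(s powr (1 / real k)) ^ k = s" if "s \<ge> 0" for s
    using that assms by (simp add: powr_realpow'[symmetric] powr_powr)
  ultimately show ?thesis
    by (simp add: vec_norm_def power_mult sum_nonneg)
qed

theorem proposition1:
  fixes \<mu> :: "nat \<Rightarrow> nat \<Rightarrow> real"
  assumes pos: "\<And>n i. i \<in> {1..n} \<Longrightarrow> \<mu> n i > 0"
    and max_tendsto: "(\<lambda>n. vec_max n (\<mu> n)) \<longlonglongrightarrow> 0"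
    and norm_tendsto: "filterlim (\<lambda>n. vec_norm 2 n (\<mu> n)) at_top sequentially"
  shows "((\<lambda>n. measure_pmf.expectation (beta_model n (\<mu> n)) (triangle_count n))
           \<sim>[sequentially] (\<lambda>n. 1/6 * vec_norm 2 n (\<mu> n) ^ 6)) \<and>
         ((\<lambda>n. measure_pmf.variance (beta_model n (\<mu> n)) (triangle_count n))
           \<sim>[sequentially]
         (\<lambda>n. 1/6 * vec_norm 2 n (\<mu> n) ^ 4 *
                (3 * vec_norm 3 n (\<mu> n) ^ 6 + vec_norm 2 n (\<mu> n) ^ 2)))"
proof -
  define S where "S = (\<lambda>k n. \<Sum>i = 1..n. \<bar>\<mu> n i\<bar> ^ k)"
  define d where "d = (\<lambda>n. vec_max n (\<mu> n) ^ 2)"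
  have norm2: "vec_norm 2 n (\<mu> n) ^ 2 = S 2 n" "vec_norm 2 n (\<mu> n) ^ 4 = S 2 n ^ 2"
      "vec_norm 2 n (\<mu> n) ^ 6 = S 2 n ^ 3" and norm3: "vec_norm 3 n (\<mu> n) ^ 6 = S 3 n ^ 2" for n
    using vec_norm_power[of 2 n "\<mu> n" 1] vec_norm_power[of 2 n "\<mu> n" 2] vec_norm_power[of 2 n "\<mu> n" 3]
      vec_norm_power[of 3 n "\<mu> n" 2] by (simp_all add: S_def)
  have "filterlim (\<lambda>n. vec_norm 2 n (\<mu> n) ^ 2) at_top sequentially"
    by (rule filterlim_pow_at_top[OF _ norm_tendsto]) simp
  then have S_top: "filterlim (S 2) at_top sequentially"
    by (simp add: norm2)
  then have S_inv: "(\<lambda>n. inverse (S 2 n)) \<longlonglongrightarrow> 0"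
    by (rule tendsto_inverse_0_at_top)
  have d: "d \<longlonglongrightarrow> 0"
    unfolding d_def using tendsto_power[OF max_tendsto, of 2] by simp
  have S_pos: "\<forall>\<^sub>F n in sequentially. S 2 n > 0"
    using S_top by (simp add: filterlim_at_top_dense)
  have max_le: "\<forall>\<^sub>F n in sequentially. vec_max n (\<mu> n) < 1"
    using max_tendsto by (rule order_tendstoD) simp
  have le_max: "\<mu> n i \<le> vec_max n (\<mu> n)" if "i \<in> {1..n}" for n i
    using that by (auto simp: vec_max_def intro!: Max_ge)
  \<comment> \<open>For \<open>n = 0\<close> the maximum is taken over the empty set and has no
    useful value.\<close>
  have max_nonneg: "0 \<le> vec_max n (\<mu> n)" if "n \<ge> 1" for n
    using le_max[of 1 n] pos[of 1 n] that by simp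
  let ?E = "\<lambda>n. measure_pmf.expectation (beta_model n (\<mu> n)) (triangle_count n)"
    and ?V = "\<lambda>n. measure_pmf.variance (beta_model n (\<mu> n)) (triangle_count n)"
  let ?R = "\<lambda>n. S 2 n ^ 3 / 6 + S 3 n ^ 2 * S 2 n ^ 2 / 2"
  let ?lE = "\<lambda>n. (1 - d n) ^ 3 * (1 - 3 * d n * inverse (S 2 n))"
    and ?lV = "\<lambda>n. (1 - d n) ^ 6 * (1 - 8 * d n * inverse (S 2 n) - 3 * d n ^ 2)"
  have ratios: "?lE n \<le> ?E n / (S 2 n ^ 3 / 6) \<and> ?E n / (S 2 n ^ 3 / 6) \<le> 1 \<and>
      ?lV n \<le> ?V n / ?R n \<and> ?V n / ?R n \<le> 1"
    if "S 2 n > 0" "vec_max n (\<mu> n) < 1" "n \<ge> 1" for n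
    using that pos le_max max_nonneg
      expectation_ratio_bounds[where n = n and \<mu> = "\<mu> n" and m = "vec_max n (\<mu> n)"]
      variance_ratio_bounds[where n = n and \<mu> = "\<mu> n" and m = "vec_max n (\<mu> n)"]
    unfolding S_def d_def by (intro conjI) (simp_all only: less_imp_le)
  note ev = S_pos max_le eventually_ge_at_top[of 1]
  have lower_E: "?lE \<longlonglongrightarrow> 1"
    by (rule tendsto_eq_intros d S_inv refl | simp)+
  have lower_V: "?lV \<longlonglongrightarrow> 1"
    by (rule tendsto_eq_intros d S_inv refl | simp)+
  \<comment> \<open>The ratio is squeezed between \<open>?lE\<close> and 1 for all large
    \<open>n\<close>, where the norm is positive and the maximum is below 1.\<close>
  have "(\<lambda>n. ?E n / (S 2 n ^ 3 / 6)) \<longlonglongrightarrow> 1"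
    by (rule tendsto_sandwich[OF _ _ lower_E tendsto_const])
      (use ev in eventually_elim, use ratios in blast)+
  then have E: "?E \<sim>[sequentially] (\<lambda>n. S 2 n ^ 3 / 6)"
    by (rule asymp_equivI')
  have "(\<lambda>n. ?V n / ?R n) \<longlonglongrightarrow> 1"
    by (rule tendsto_sandwich[OF _ _ lower_V tendsto_const])
      (use ev in eventually_elim, use ratios in blast)+
  then have V: "?V \<sim>[sequentially] ?R"
    by (rule asymp_equivI')
  have R: "?R = (\<lambda>n. 1 / 6 * S 2 n ^ 2 * (3 * S 3 n ^ 2 + S 2 n))"
    by (simp add: fun_eq_iff field_simps eval_nat_numeral)
  show ?thesis
    using E V unfolding R norm2 norm3 by simp
qed

end
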